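(* Let $q=2^h$, $\alpha,\beta\in\mathbb{F}_q\setminus\{0,1\}$ with $\alpha\beta\neq 1$, and $a,a',b,b'\in\mathbb{F}_2$. Then the KM-arcs $\mathcal{A}_{\alpha,\beta,a,b}$ and $\mathcal{A}_{\alpha,\beta,a',b'}$ are $\mathrm{PGL}(3,q)$-equivalent.
   Context: Let $\mathrm{Tr}$ be the absolute trace $\mathbb{F}_q\to\mathbb{F}_2$. For $\alpha,\beta\in\mathbb{F}_q\setminus\{0,1\}$ with $\alpha\beta\ne1$, put $\gamma=\frac{\beta+1}{\alpha\beta+1}$, $\xi=\alpha\beta\gamma$, and for $a,b\in\mathbb{F}_2$ let $\mathcal{A}_{\alpha,\beta,a,b}\subseteq\mathrm{PG}(2,q)$ be the union of $S_0=\{(z,1,0): \mathrm{Tr}(z)=0,\mathrm{Tr}(z/\alpha)=a\}$, $S_1=\{(z,0,1):\mathrm{Tr}(z)=0,\mathrm{Tr}(z/(\alpha\gamma))=0\}$, $S_2=\{(z,1,1):\mathrm{Tr}(z)=1,\mathrm{Tr}(z/(\alpha\beta))=b\}$, $S_3=\{(z,\gamma,1):\mathrm{Tr}(z/(\alpha\gamma))=a+1,\mathrm{Tr}(z/\xi)=b+1\}$, $S_4=\{(z,\beta+1,1):\mathrm{Tr}(z/(\alpha\beta))=a+b+1,\mathrm{Tr}(z/\xi)=b\}$ ($z\in\mathbb{F}_q$). This set is a KM-arc of type $q/4$, i.e. a set of $q+q/4$ points such that every line meets it in $0$, $2$ or $q/4$ points. *)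

theory Defs
  imports "HOL-Analysis.Cartesian_Space" "HOL-Library.FuncSet"
begin

text \<open>
  Throughout, the field \<open>\<F>\<^sub>q\<close> with \<open>q = 2 ^ h\<close> is a type \<open>'a\<close> of class \<open>{field, finite}\<close> with
  \<open>CARD('a) = 2 ^ h\<close>, and \<open>\<F>\<^sub>2\<close> is its prime field, the subset \<open>{0, 1}\<close>.
\<close>

text \<open>The trace of the extension of degree \<open>h\<close> over the prime field: the sum of the conjugates.\<close>
definition abs_trace :: "nat \<Rightarrow> 'a::field \<Rightarrow> 'a" where
  "abs_trace h x = (\<Sum>i<h. x ^ (2 ^ i))"

text \<open>Points of the projective plane are the one-dimensional subspaces of the vector space of
  triples; \<open>hpoint x y z\<close> is the point with homogeneous coordinates \<open>(x, y, z)\<close>.\<close>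
definition PG2 :: "('a::field ^ 3) set set" where
  "PG2 = {vec.span {v} | v. v \<noteq> 0}"

definition hpoint :: "'a::field \<Rightarrow> 'a \<Rightarrow> 'a \<Rightarrow> ('a ^ 3) set" where
  "hpoint x y z = vec.span {vector [x, y, z]}"

lemma hpoint_in_PG2:
  assumes "y \<noteq> 0 \<or> z \<noteq> 0"
  shows "hpoint x y z \<in> PG2"
proof -
  have "(vector [x, y, z] :: 'a ^ 3) \<noteq> 0"
    using assms by (metis vector_3(2) vector_3(3) zero_index)
  then show ?thesis
    unfolding PG2_def hpoint_def by blast
qed

text \<open>The permutations of the points induced by invertible matrices. The restriction to points
  identifies matrices that differ by a nonzero scalar.\<close>
definition PGL3 :: "(('a::field ^ 3) set \<Rightarrow> ('a ^ 3) set) set" where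
  "PGL3 = {restrict (\<lambda>P. (*v) M ` P) PG2 | M :: 'a ^ 3 ^ 3. invertible M}"

definition PGL3_equivalent :: "('a::field ^ 3) set set \<Rightarrow> ('a ^ 3) set set \<Rightarrow> bool" where
  "PGL3_equivalent A B \<longleftrightarrow> (\<exists>\<phi>\<in>PGL3. \<phi> ` A = B)"

definition km_arc :: "nat \<Rightarrow> 'a::field \<Rightarrow> 'a \<Rightarrow> 'a \<Rightarrow> 'a \<Rightarrow> ('a ^ 3) set set" where
  "km_arc h \<alpha> \<beta> a b =
    (let Tr = abs_trace h;
         \<gamma> = (\<beta> + 1) / (\<alpha> * \<beta> + 1);
         \<xi> = \<alpha> * \<beta> * \<gamma>
     in {hpoint z 1 0 | z. Tr z = 0 \<and> Tr (z / \<alpha>) = a}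
      \<union> {hpoint z 0 1 | z. Tr z = 0 \<and> Tr (z / (\<alpha> * \<gamma>)) = 0}
      \<union> {hpoint z 1 1 | z. Tr z = 1 \<and> Tr (z / (\<alpha> * \<beta>)) = b}
      \<union> {hpoint z \<gamma> 1 | z. Tr (z / (\<alpha> * \<gamma>)) = a + 1 \<and> Tr (z / \<xi>) = b + 1}
      \<union> {hpoint z (\<beta> + 1) 1 | z. Tr (z / (\<alpha> * \<beta>)) = a + b + 1 \<and> Tr (z / \<xi>) = b})"

lemma km_arc_subset_PG2: "km_arc h \<alpha> \<beta> a b \<subseteq> PG2"
  unfolding km_arc_def Let_def by (auto intro: hpoint_in_PG2)

end

theory Submission
  imports Defs "HOL-Computational_Algebra.Polynomial" "HOL-Analysis.Determinants"
begin

text \<open>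
  The collineations \<open>(x, y, z) \<mapsto> (x + u y + v z, y, z)\<close> preserve each of the five lines through
  \<open>(1, 0, 0)\<close> that carry the arc and translate the first coordinate on it. By additivity of
  the trace, such a map takes the arc for \<open>(a, b)\<close> to the arc for \<open>(a', b')\<close> as soon as
  \<open>Tr u = 0\<close>, \<open>Tr (u/\<alpha>) = a + a'\<close>, \<open>Tr v = Tr (v/(\<alpha>\<gamma>)) = 0\<close> and \<open>Tr ((u + v)/(\<alpha>\<beta>)) = b + b'\<close>;
  the remaining conditions are dependent because \<open>1/\<xi> = 1/(\<alpha>\<beta>) + 1 + 1/(\<alpha>\<gamma>)\<close>. Trace conditions can be
  prescribed freely on elements independent over the prime field. With \<open>v = 0\<close> this settles the case
  that \<open>1, 1/\<alpha>, 1/(\<alpha>\<beta>)\<close> are independent. Otherwise \<open>\<alpha>\<beta> = \<beta> + 1\<close> and \<open>\<gamma> = \<alpha>\<close>, and a suitable \<open>v\<close> exists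
  unless \<open>\<alpha>\<^sup>2 = \<alpha> + 1\<close>. In that last case \<open>\<alpha> = \<beta>\<close> is a primitive cube root of unity, and a map that also
  scales \<open>x\<close> by a cube root of unity is needed.
\<close>

section \<open>Collineations fixing the lines through a point\<close>

lemma image_span_singleton: "(*v) M ` vec.span {v} = vec.span {M *v v}"
  for M :: "'a::field ^ 'n ^ 'm"
  using vec.linear_span_image[of "(*v) M" "{v}"] by simp

lemma image_restrict_subset: "B \<subseteq> A \<Longrightarrow> restrict f A ` B = f ` B"
  by (rule image_cong) auto

lemma PGL3_equivalentI:
  fixes M :: "'a::field ^ 3 ^ 3"
  assumes "invertible M" "A \<subseteq> PG2" "(\<lambda>P. (*v) M ` P) ` A = B"
  shows "PGL3_equivalent A B"
  unfolding PGL3_equivalent_def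
proof (rule bexI)
  show "restrict (\<lambda>P. (*v) M ` P) PG2 ` A = B"
    using assms(2,3) by (simp only: image_restrict_subset)
  show "restrict (\<lambda>P. (*v) M ` P) PG2 \<in> PGL3"
    using assms(1) unfolding PGL3_def by blast
qed

lemma PGL3_equivalent_sym:
  assumes "PGL3_equivalent A B" "A \<subseteq> PG2" "B \<subseteq> PG2"
  shows "PGL3_equivalent B A"
proof -
  obtain M :: "'a ^ 3 ^ 3" where M: "invertible M" "restrict (\<lambda>P. (*v) M ` P) PG2 ` A = B"
    using assms(1) unfolding PGL3_equivalent_def PGL3_def by blast
  from M(2) assms(2) have B: "(\<lambda>P. (*v) M ` P) ` A = B"
    by (simp only: image_restrict_subset)
  obtain N where N: "N ** M = mat 1" "M ** N = mat 1"
    using M(1) unfolding invertible_def by blast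
  have "(*v) N ` (*v) M ` P = P" for P
    by (simp add: image_image matrix_vector_mul_assoc N)
  then have "(\<lambda>P. (*v) N ` P) ` B = A"
    unfolding B[symmetric] image_image by simp
  moreover have "invertible N"
    using N unfolding invertible_def by blast
  ultimately show ?thesis
    using assms(3) by (intro PGL3_equivalentI)
qed

text \<open>For \<open>c \<noteq> 0\<close> these are the central collineations with centre (1, 0,
  0): elations when \<open>c = 1\<close>, homologies otherwise.\<close>

definition axial :: "'a::field \<Rightarrow> 'a \<Rightarrow> 'a \<Rightarrow> 'a ^ 3 ^ 3" where
  "axial c u v = vector [vector [c, u, v], vector [0, 1, 0], vector [0, 0, 1]]"

lemma invertible_axial: "c \<noteq> 0 \<Longrightarrow> invertible (axial c u v)"
  by (simp add: invertible_det_nz det_3 axial_def)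

lemma axial_hpoint: "(*v) (axial c u v) ` hpoint x y z = hpoint (c * x + u * y + v * z) y z"
proof -
  have "axial c u v *v vector [x, y, z] = vector [c * x + u * y + v * z, y, z]"
    by (simp add: vec_eq_iff forall_3 axial_def matrix_vector_mult_def sum_3)
  then show ?thesis
    by (simp add: hpoint_def image_span_singleton)
qed

text \<open>As \<open>c \<noteq> 0\<close>, the map on first coordinates is a bijection of the
  field, so an equivalence of the conditions yields equality of the sets, not just
  inclusion.\<close>

lemma axial_image:
  assumes "c \<noteq> 0" "\<And>x. P x \<longleftrightarrow> Q (c * x + (u * y + v * z))"
  shows "(\<lambda>X. (*v) (axial c u v) ` X) ` {hpoint x y z | x. P x} = {hpoint x y z | x. Q x}"
proof -
  have "\<exists>x. t = c * x + (u * y + v * z)" for t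
    using assms(1) by (intro exI[of _ "(t - (u * y + v * z)) / c"]) simp
  then have "{hpoint x y z | x. Q x} = {hpoint (c * x + (u * y + v * z)) y z | x. P x}"
    unfolding assms(2) by (intro Collect_cong) metis
  also have "\<dots> = (\<lambda>X. (*v) (axial c u v) ` X) ` {hpoint x y z | x. P x}"
    by (auto simp: axial_hpoint add.assoc setcompr_eq_image image_image)
  finally show ?thesis ..
qed

text \<open>On each piece \<open>y\<close> and \<open>z\<close> are constant, so the map acts on it
  by \<open>c\<close> and a constant shift \<open>u * y + v * z\<close>; the pieces can be matched
  one by one.\<close>

lemma km_arc_axial_equivalent:
  fixes \<alpha> \<beta> a a' b b' c u v :: "'a::field" and h :: nat
  defines "\<gamma> \<equiv> (\<beta> + 1) / (\<alpha> * \<beta> + 1)"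
  defines "\<xi> \<equiv> \<alpha> * \<beta> * \<gamma>"
  defines "Tr \<equiv> abs_trace h"
  assumes c: "c \<noteq> 0"
    and S0: "\<And>z. Tr z = 0 \<and> Tr (z / \<alpha>) = a \<longleftrightarrow>
        Tr (c * z + u) = 0 \<and> Tr ((c * z + u) / \<alpha>) = a'"
    and S1: "\<And>z. Tr z = 0 \<and> Tr (z / (\<alpha> * \<gamma>)) = 0 \<longleftrightarrow>
        Tr (c * z + v) = 0 \<and> Tr ((c * z + v) / (\<alpha> * \<gamma>)) = 0"
    and S2: "\<And>z. Tr z = 1 \<and> Tr (z / (\<alpha> * \<beta>)) = b \<longleftrightarrow>
        Tr (c * z + (u + v)) = 1 \<and> Tr ((c * z + (u + v)) / (\<alpha> * \<beta>)) = b'"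
    and S3: "\<And>z. Tr (z / (\<alpha> * \<gamma>)) = a + 1 \<and> Tr (z / \<xi>) = b + 1 \<longleftrightarrow>
        Tr ((c * z + (u * \<gamma> + v)) / (\<alpha> * \<gamma>)) = a' + 1 \<and> Tr ((c * z + (u * \<gamma> + v)) / \<xi>) = b' + 1"
    and S4: "\<And>z. Tr (z / (\<alpha> * \<beta>)) = a + b + 1 \<and> Tr (z / \<xi>) = b \<longleftrightarrow>
        Tr ((c * z + (u * (\<beta> + 1) + v)) / (\<alpha> * \<beta>)) = a' + b' + 1 \<and>
        Tr ((c * z + (u * (\<beta> + 1) + v)) / \<xi>) = b'"
  shows "PGL3_equivalent (km_arc h \<alpha> \<beta> a b) (km_arc h \<alpha> \<beta> a' b')"
proof (rule PGL3_equivalentI)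
  show "invertible (axial c u v)"
    by (rule invertible_axial[OF c])
  show "km_arc h \<alpha> \<beta> a b \<subseteq> PG2"
    by (rule km_arc_subset_PG2)
  show "(\<lambda>X. (*v) (axial c u v) ` X) ` km_arc h \<alpha> \<beta> a b = km_arc h \<alpha> \<beta> a' b'"
    unfolding km_arc_def Let_def image_Un \<gamma>_def[symmetric] \<xi>_def[symmetric] Tr_def[symmetric]
    using S0 S1 S2 S3 S4 by (intro arg_cong2[where f = "(\<union>)"] axial_image[OF c]) simp_all
qed

section \<open>The trace of a finite field of even order\<close>

lemma finite_field_power_card:
  fixes x :: "'a::{field, finite}"
  shows "x ^ CARD('a) = x"
proof (cases "x = 0")
  case False
  let ?U = "UNIV - {0 :: 'a}"
  \<comment> \<open>Multiplication by \<open>x\<close> permutes the nonzero elements; compare the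
    products over them.\<close>
  have "bij_betw ((*) x) ?U ?U"
    by (rule bij_betwI[where g = "\<lambda>y. y / x"]) (use False in auto)
  then have "(\<Prod>y\<in>?U. y) = (\<Prod>y\<in>?U. x * y)"
    by (rule prod.reindex_bij_betw[symmetric])
  also have "\<dots> = x ^ card ?U * (\<Prod>y\<in>?U. y)"
    by (simp add: prod.distrib)
  finally have "x ^ card ?U = 1"
    by simp
  moreover have "CARD('a) = Suc (card ?U)"
    by (simp add: card_Diff_singleton)
  ultimately show ?thesis
    by (simp only: power_Suc mult_1_right)
qed simp

lemma CHAR_eq_2_if_CARD:
  assumes "CARD('a::{field, finite}) = 2 ^ h"
  shows "CHAR('a) = 2"
proof -
  have "prime CHAR('a)"
    by (rule prime_CHAR_semidom) (simp add: finite_imp_CHAR_pos)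
  moreover have "CHAR('a) dvd 2 ^ h"
  proof -
    \<comment> \<open>Translation by 1 permutes the field, so comparing the sums of all elements
      shows that q vanishes in it.\<close>
    have "bij_betw ((+) 1) UNIV (UNIV :: 'a set)"
      by (rule bij_betwI[where g = "\<lambda>y. y - 1"]) auto
    then have "(\<Sum>y\<in>UNIV. y :: 'a) = (\<Sum>y\<in>UNIV. 1 + y)"
      by (rule sum.reindex_bij_betw[symmetric])
    then have "of_nat CARD('a) = (0 :: 'a)"
      by (simp add: sum.distrib)
    then show ?thesis
      by (simp only: of_nat_eq_0_iff_char_dvd assms)
  qed
  ultimately show ?thesis
    by (metis prime_dvd_power primes_dvd_imp_eq two_is_prime_nat)
qed

context
  fixes h :: nat
  assumes card: "CARD('a::{field, finite}) = 2 ^ h"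
begin

lemma char2_add_self: "x + x = 0" for x :: 'a
  by (metis CHAR_eq_2_if_CARD[OF card] add.right_inverse uminus_CHAR_2)

lemma char2_add_self_left: "x + (x + y) = y" for x y :: 'a
  by (simp add: char2_add_self flip: add.assoc)

lemma char2_two_eq_0: "(2 :: 'a) = 0"
  using char2_add_self[of 1] by simp

lemma char2_add_eq_iff: "x + y = z \<longleftrightarrow> x = z + y" for x y z :: 'a
  by (metis add.assoc add.right_neutral char2_add_self)

lemma prime_CHAR: "prime CHAR('a)"
  by (simp add: CHAR_eq_2_if_CARD[OF card])

lemma abs_trace_add: "abs_trace h (x + y) = abs_trace h x + abs_trace h y" for x y :: 'a
  unfolding abs_trace_def sum.distrib[symmetric]
  by (intro sum.cong refl freshmans_dream' prime_CHAR) (simp add: CHAR_eq_2_if_CARD[OF card])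

lemma abs_trace_0: "abs_trace h (0 :: 'a) = 0"
  by (simp add: abs_trace_def power_0_left)

text \<open>Squaring shifts the conjugates cyclically, because \<open>x ^ 2 ^ h = x\<close>. The
  trace is thus its own square.\<close>

lemma abs_trace_cases: "abs_trace h x = 0 \<or> abs_trace h x = 1" for x :: 'a
proof -
  have "abs_trace h x ^ 2 = (\<Sum>i<h. (x ^ 2 ^ i) ^ 2)"
    unfolding abs_trace_def
    by (intro freshmans_dream_sum prime_CHAR) (simp add: CHAR_eq_2_if_CARD[OF card])
  also have "\<dots> = (\<Sum>i<h. x ^ 2 ^ Suc i)"
    by (simp add: mult.commute flip: power_mult)
  also have "\<dots> = (\<Sum>i<Suc h. x ^ 2 ^ i) - x"
    by (simp add: sum.lessThan_Suc_shift del: sum.lessThan_Suc power_Suc)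
  also have "\<dots> = abs_trace h x"
    using finite_field_power_card[of x] by (simp add: abs_trace_def card)
  finally show ?thesis
    by (simp add: power2_eq_square)
qed

text \<open>The trace is a polynomial function of degree at most \<open>2 ^ (h - 1)\<close>, too
  small to vanish on all q elements; its linear coefficient, from \<open>i = 0\<close>, is
  1.\<close>

lemma abs_trace_nonzero: "\<exists>x :: 'a. abs_trace h x \<noteq> 0"
proof (rule ccontr)
  assume "\<not> ?thesis"
  then have all0: "{x :: 'a. poly (\<Sum>i<h. monom 1 (2 ^ i)) x = 0} = UNIV"
    by (auto simp: poly_sum poly_monom abs_trace_def)
  have h: "h > 0"
    using card card_gt_0_iff[of "UNIV :: 'a set"] card_2_iff'
    by (metis UNIV_I card_1_singletonE gr0I power_0 singletonD zero_neq_one)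
  let ?p = "\<Sum>i<h. monom (1 :: 'a) (2 ^ i)"
  have "coeff ?p 1 = (\<Sum>i<h. if i = 0 then 1 else 0)"
    unfolding coeff_sum by (intro sum.cong) auto
  also have "\<dots> = 1"
    using h by simp
  finally have "?p \<noteq> 0"
    by (metis coeff_0 zero_neq_one)
  then have "CARD('a) \<le> degree ?p"
    unfolding all0[symmetric] by (rule card_poly_roots_bound)
  also have "degree ?p \<le> 2 ^ (h - 1)"
    by (intro degree_sum_le) (auto simp: degree_monom_eq intro!: power_increasing)
  finally show False
    using h card by (simp add: power_eq_if split: if_splits)
qed

section \<open>Prescribing traces on multipliers independent over the prime field\<close>

lemma ex_trace_1:
  fixes c :: 'a
  assumes "c \<noteq> 0"
  shows "\<exists>x. abs_trace h (c * x) = 1"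
proof -
  obtain y :: 'a where "abs_trace h y \<noteq> 0"
    using abs_trace_nonzero by blast
  with abs_trace_cases[of y] assms show ?thesis
    by (intro exI[of _ "y / c"]) simp
qed

lemma ex_trace_10:
  fixes c d :: 'a
  assumes "c \<noteq> 0" "c \<noteq> d"
  shows "\<exists>x. abs_trace h (c * x) = 1 \<and> abs_trace h (d * x) = 0"
proof (rule ccontr)
  assume none: "\<not> ?thesis"
  obtain x where x: "abs_trace h (c * x) = 1"
    using ex_trace_1[OF assms(1)] by blast
  have "c + d \<noteq> 0"
    using assms(2) by (simp add: char2_add_eq_iff)
  then obtain y where y: "abs_trace h (c * y) + abs_trace h (d * y) = 1"
    using ex_trace_1[of "c + d"] by (auto simp: distrib_right abs_trace_add)
  \<comment> \<open>By \<open>none\<close>, both traces of \<open>x\<close> are 1, while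
    \<open>y\<close> has trace 0 against \<open>c\<close> and 1 against \<open>d\<close>. Adding
    \<open>y\<close> therefore corrects the second trace only.\<close>
  from none x y have "abs_trace h (c * (x + y)) = 1" "abs_trace h (d * (x + y)) = 0"
    using abs_trace_cases[of "d * x"] abs_trace_cases[of "c * y"] abs_trace_cases[of "d * y"]
    by (auto simp: distrib_left abs_trace_add char2_add_self)
  with none show False
    by blast
qed

text \<open>The hypotheses put \<open>c\<close> outside the span of \<open>d\<close> and
  \<open>e\<close> over the prime field. The correcting \<open>y\<close> is chosen with trace 0
  against \<open>d\<close>, so that condition survives.\<close>

lemma ex_trace_100:
  fixes c d e :: 'a
  assumes "c \<noteq> 0" "c \<noteq> d" "c \<noteq> e" "c \<noteq> d + e"
  shows "\<exists>x. abs_trace h (c * x) = 1 \<and> abs_trace h (d * x) = 0 \<and> abs_trace h (e * x) = 0"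
proof (rule ccontr)
  assume none: "\<not> ?thesis"
  obtain x where x: "abs_trace h (c * x) = 1" "abs_trace h (d * x) = 0"
    using ex_trace_10[OF assms(1,2)] by blast
  have "c + e \<noteq> 0" "c + e \<noteq> d"
    using assms(3,4) by (simp_all add: char2_add_eq_iff)
  then obtain y where y: "abs_trace h (c * y) + abs_trace h (e * y) = 1" "abs_trace h (d * y) = 0"
    using ex_trace_10[of "c + e" d] by (auto simp: distrib_right abs_trace_add)
  from none x y have "abs_trace h (c * (x + y)) = 1" "abs_trace h (d * (x + y)) = 0"
    "abs_trace h (e * (x + y)) = 0"
    using abs_trace_cases[of "e * x"] abs_trace_cases[of "c * y"] abs_trace_cases[of "e * y"]
    by (auto simp: distrib_left abs_trace_add char2_add_self)
  with none show False
    by blast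
qed

lemma ex_trace_eq2:
  fixes c d r s :: 'a
  assumes "c \<noteq> 0" "d \<noteq> 0" "c \<noteq> d" and "r \<in> {0, 1}" "s \<in> {0, 1}"
  shows "\<exists>x. abs_trace h (c * x) = r \<and> abs_trace h (d * x) = s"
proof -
  obtain x where x: "abs_trace h (c * x) = 1" "abs_trace h (d * x) = 0"
    using ex_trace_10[of c d] assms by blast
  obtain y where y: "abs_trace h (d * y) = 1" "abs_trace h (c * y) = 0"
    using ex_trace_10[of d c] assms by blast
  \<comment> \<open>\<open>x\<close> and \<open>y\<close> are dual to \<open>c\<close> and
    \<open>d\<close> under the trace form, so the target values serve as coefficients.\<close>
  from x y assms(4,5) show ?thesis
    by (intro exI[of _ "r * x + s * y"]) (auto simp: distrib_left abs_trace_add abs_trace_0)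
qed

lemma ex_trace_eq3:
  fixes c d e r s t :: 'a
  assumes "c \<noteq> 0" "d \<noteq> 0" "e \<noteq> 0" "c \<noteq> d" "c \<noteq> e" "d \<noteq> e" "c \<noteq> d + e"
    and "r \<in> {0, 1}" "s \<in> {0, 1}" "t \<in> {0, 1}"
  shows "\<exists>x. abs_trace h (c * x) = r \<and> abs_trace h (d * x) = s \<and> abs_trace h (e * x) = t"
proof -
  have ne: "d \<noteq> c + e" "e \<noteq> c + d"
    using assms(7) by (metis add.commute char2_add_eq_iff)+
  obtain x where x: "abs_trace h (c * x) = 1" "abs_trace h (d * x) = 0" "abs_trace h (e * x) = 0"
    using ex_trace_100[of c d e] assms by blast
  obtain y where y: "abs_trace h (d * y) = 1" "abs_trace h (c * y) = 0" "abs_trace h (e * y) = 0"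
    using ex_trace_100[of d c e] assms ne by metis
  obtain z where z: "abs_trace h (e * z) = 1" "abs_trace h (c * z) = 0" "abs_trace h (d * z) = 0"
    using ex_trace_100[of e c d] assms ne by metis
  from x y z assms(8-10) show ?thesis
    by (intro exI[of _ "r * x + s * y + t * z"])
      (auto simp: distrib_left abs_trace_add abs_trace_0)
qed


section \<open>Equivalences between the arcs\<close>

lemma km_arc_elation_equivalent:
  fixes \<alpha> \<beta> a a' b b' u v :: 'a
  defines "\<gamma> \<equiv> (\<beta> + 1) / (\<alpha> * \<beta> + 1)"
  assumes "\<alpha> \<noteq> 0" "\<beta> \<noteq> 0" "\<beta> \<noteq> 1" "\<alpha> * \<beta> \<noteq> 1"
    and u: "abs_trace h u = 0" "abs_trace h (u / \<alpha>) = a + a'"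
    and v: "abs_trace h v = 0" "abs_trace h (v / (\<alpha> * \<gamma>)) = 0"
    and uv: "abs_trace h (u / (\<alpha> * \<beta>)) + abs_trace h (v / (\<alpha> * \<beta>)) = b + b'"
  shows "PGL3_equivalent (km_arc h \<alpha> \<beta> a b) (km_arc h \<alpha> \<beta> a' b')"
proof -
  have nz: "\<beta> + 1 \<noteq> 0" "\<alpha> * \<beta> + 1 \<noteq> 0"
    using assms(4,5) by (simp_all add: char2_add_eq_iff)
  then have \<gamma>: "\<gamma> \<noteq> 0"
    by (simp add: \<gamma>_def)
  let ?\<xi> = "\<alpha> * \<beta> * \<gamma>"
  have v\<xi>: "v / ?\<xi> = v / (\<alpha> * \<beta>) + (v + v / (\<alpha> * \<gamma>))"
  proof -
    \<comment> \<open>Cleared of the denominator \<open>\<alpha> * \<beta> * D\<close>, the claim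
      holds because \<open>D + \<alpha> * \<beta> * D = D * E = E + \<beta> * E\<close> and the two
      copies of \<open>\<beta> * E\<close> cancel.\<close>
    define D E where DE: "D = \<beta> + 1" "E = \<alpha> * \<beta> + 1"
    have "v * D + v * \<alpha> * \<beta> * D + v * \<beta> * E = v * E + (v * \<beta> * E + v * \<beta> * E)"
      by (simp add: DE algebra_simps)
    then have "v / ?\<xi> = (v * D + v * \<alpha> * \<beta> * D + v * \<beta> * E) / (\<alpha> * \<beta> * D)"
      by (simp add: char2_add_self \<gamma>_def flip: DE)
    also have "\<dots> = v / (\<alpha> * \<beta>) + (v + v / (\<alpha> * \<gamma>))"
      using nz assms(2,3) by (simp add: add_divide_distrib \<gamma>_def flip: DE)
    finally show ?thesis .
  qed
  have u\<gamma>: "u * \<gamma> / (\<alpha> * \<gamma>) = u / \<alpha>" "u * \<gamma> / ?\<xi> = u / (\<alpha> * \<beta>)"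
    using \<gamma> by simp_all
  have u\<beta>: "u * (\<beta> + 1) / (\<alpha> * \<beta>) = u / \<alpha> + u / (\<alpha> * \<beta>)"
    using assms(2,3) by (simp add: distrib_left add_divide_distrib)
  have "u * (\<beta> + 1) / ?\<xi> = u * (\<alpha> * \<beta> + 1) / (\<alpha> * \<beta>)"
    using nz by (simp add: \<gamma>_def)
  also have "\<dots> = u + u / (\<alpha> * \<beta>)"
    using assms(2,3) by (simp add: distrib_left add_divide_distrib)
  finally have u\<beta>': "u * (\<beta> + 1) / ?\<xi> = u + u / (\<alpha> * \<beta>)" .
  \<comment> \<open>Adding \<open>s + s'\<close> turns the required value \<open>s\<close> into
    \<open>s'\<close>; \<open>r\<close> carries the offset 1 in the last two pieces.\<close>
  have shift: "x + (s + s') = s' + r \<longleftrightarrow> x = s + r" for x s s' r :: 'a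
    by (metis (no_types, lifting) add.assoc add.commute add_left_cancel char2_add_eq_iff)
  have shift0: "x + (s + s') = s' \<longleftrightarrow> x = s" for x s s' :: 'a
    using shift[of x s s' 0] by simp
  have uv': "abs_trace h ((u + v) / (\<alpha> * \<beta>)) = b + b'"
    using uv by (simp add: add_divide_distrib abs_trace_add)
  have s3: "abs_trace h ((u * \<gamma> + v) / (\<alpha> * \<gamma>)) = a + a'"
    using u v by (simp add: add_divide_distrib u\<gamma> abs_trace_add)
  have s3': "abs_trace h ((u * \<gamma> + v) / ?\<xi>) = b + b'"
    using u v uv by (simp add: add_divide_distrib u\<gamma> v\<xi> abs_trace_add)
  have "abs_trace h ((u * (\<beta> + 1) + v) / (\<alpha> * \<beta>)) = (a + a') + (b + b')"
    unfolding uv[symmetric] u(2)[symmetric]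
    by (simp only: add_divide_distrib u\<beta> abs_trace_add add.assoc)
  then have s4: "abs_trace h ((u * (\<beta> + 1) + v) / (\<alpha> * \<beta>)) = (a + b) + (a' + b')"
    by (simp only: add_ac)
  have s4': "abs_trace h ((u * (\<beta> + 1) + v) / ?\<xi>) = b + b'"
    unfolding uv[symmetric]
    using u v by (simp only: add_divide_distrib[of "u * _"] u\<beta>' v\<xi> abs_trace_add) simp
  have tr: "abs_trace h ((1 * z + k) / d) = abs_trace h (z / d) + abs_trace h (k / d)"
    "abs_trace h (1 * z + k) = abs_trace h z + abs_trace h k" for z k d :: 'a
    by (simp_all add: add_divide_distrib abs_trace_add)
  show ?thesis
    by (rule km_arc_axial_equivalent[where c = 1 and u = u and v = v])
      (simp_all only: \<gamma>_def[symmetric] tr abs_trace_add[of u v] u v uv' s3 s3' s4 s4'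
        add_0_right shift shift0 one_neq_zero not_False_eq_True)
qed

text \<open>If \<open>\<alpha> = \<beta>\<close> is a primitive cube root of unity, every elation fixing the five lines through
  \<open>(1, 0, 0)\<close> preserves \<open>a + b\<close>. Here each piece of the arc is a fibre of the trace to \<open>\<F>\<^sub>4\<close> over a point
  of a conic \<open>x\<^sup>2 = k y z\<close> of \<open>PG(2,4)\<close> (for \<open>a = 0\<close>), and scaling \<open>x\<close> by \<open>\<omega> + 1 = \<omega>\<^sup>2\<close> changes \<open>k\<close>.\<close>
lemma km_arc_cube_root_equivalent:
  fixes \<omega> a a' :: 'a
  assumes \<omega>: "\<omega> * \<omega> = \<omega> + 1" "\<omega> \<noteq> 0" and a: "a \<in> {0, 1}" "a' \<in> {0, 1}"
  shows "PGL3_equivalent (km_arc h \<omega> \<omega> a a) (km_arc h \<omega> \<omega> a' (a' + 1))"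
proof -
  have \<omega>1: "\<omega> \<noteq> 1"
    using \<omega>(1) char2_add_self[of 1] by auto
  \<comment> \<open>Both values are forced by the piece with coordinates \<open>(z, 1, 0)\<close>:
    where Tr(z) = 0 and Tr(\<omega> z) = a, the image has trace a + Tr(u), and \<omega> times it has
    trace Tr(\<omega> u).\<close>
  obtain u where u: "abs_trace h u = a" "abs_trace h (\<omega> * u) = a'"
    using ex_trace_eq2[of 1 \<omega> a a'] \<omega>(2) \<omega>1 a by auto
  have mul: "\<omega> * (\<omega> * x) = \<omega> * x + x" for x
    using \<omega>(1) by (simp add: distrib_right flip: mult.assoc)
  have \<omega>11: "\<omega> * \<omega> + 1 = \<omega>"
    by (simp add: \<omega>(1) add.assoc char2_add_self)
  have \<gamma>: "(\<omega> + 1) / (\<omega> * \<omega> + 1) = \<omega>"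
  proof -
    have "(\<omega> + 1) / (\<omega> * \<omega> + 1) = \<omega> * \<omega> / \<omega>"
      unfolding \<omega>11 by (simp only: \<omega>(1))
    then show ?thesis
      by simp
  qed
  have \<omega>3: "\<omega> * \<omega> * \<omega> = 1"
    using mul[of 1] \<omega>(1) by (simp add: distrib_right char2_add_self char2_add_self_left add_ac)
  have inv: "inverse \<omega> = \<omega> * \<omega>" "inverse (\<omega> * \<omega>) = \<omega>"
    by (rule inverse_unique; simp only: \<omega>3 mult.assoc[symmetric])+
  have div1: "x / \<omega> = \<omega> * x + x" for x
    by (simp only: divide_inverse inv mul[symmetric] mult_ac)
  have div2: "x / (\<omega> * \<omega>) = \<omega> * x" for x
    by (simp only: divide_inverse inv mult.commute)
  \<comment> \<open>Since \<omega>(\<omega> + 1) = 1, scaling acts linearly on the pair Tr(z),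
    Tr(\<omega> z). All five conditions depend only on this pair, which leaves a finite
    check.\<close>
  have tr: "abs_trace h ((\<omega> + 1) * z) = abs_trace h (\<omega> * z) + abs_trace h z"
    "abs_trace h (\<omega> * ((\<omega> + 1) * z)) = abs_trace h z"
    "abs_trace h (\<omega> * ((\<omega> + 1) * z + k)) = abs_trace h z + abs_trace h (\<omega> * k)" for z k
    by (simp_all add: distrib_left distrib_right mul abs_trace_add char2_two_eq_0)
  have tru: "abs_trace h (u * \<omega>) = a'" "abs_trace h (\<omega> * (u * \<omega>)) = a' + a"
    "abs_trace h (u * (\<omega> + 1)) = a' + a" "abs_trace h (\<omega> * (u * (\<omega> + 1))) = a"
    by (simp_all add: u mul mult.commute[of u] distrib_left distrib_right abs_trace_add
        char2_add_self char2_add_self_left add_ac)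
  have "\<omega> + 1 \<noteq> 0"
    using \<omega> by auto
  then show ?thesis
    apply (rule km_arc_axial_equivalent[where c = "\<omega> + 1" and u = u and v = 0])
        apply (unfold \<gamma> \<omega>3 div_by_1 div1 div2 add_0_right abs_trace_add tr u tru
          mult_zero_right abs_trace_0)
    subgoal for z
      using a abs_trace_cases[of z] abs_trace_cases[of "\<omega> * z"]
      by (elim insertE disjE emptyE) (simp_all add: char2_two_eq_0)
    subgoal for z
      using a abs_trace_cases[of z] abs_trace_cases[of "\<omega> * z"]
      by (elim insertE disjE emptyE) (simp_all add: char2_two_eq_0)
    subgoal for z
      using a abs_trace_cases[of z] abs_trace_cases[of "\<omega> * z"]
      by (elim insertE disjE emptyE) (simp_all add: char2_two_eq_0)
    subgoal for z
      using a abs_trace_cases[of z] abs_trace_cases[of "\<omega> * z"]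
      by (elim insertE disjE emptyE) (simp_all add: char2_two_eq_0)
    subgoal for z
      using a abs_trace_cases[of z] abs_trace_cases[of "\<omega> * z"]
      by (elim insertE disjE emptyE) (simp_all add: char2_two_eq_0)
    done
qed

end

theorem theorem4p8:
  fixes \<alpha> \<beta> a a' b b' :: "'a::{field, finite}" and h :: nat
  assumes "CARD('a) = 2 ^ h"
    and "\<alpha> \<notin> {0, 1}" and "\<beta> \<notin> {0, 1}" and "\<alpha> * \<beta> \<noteq> 1"
    and "a \<in> {0, 1}" and "a' \<in> {0, 1}" and "b \<in> {0, 1}" and "b' \<in> {0, 1}"
  shows "PGL3_equivalent (km_arc h \<alpha> \<beta> a b) (km_arc h \<alpha> \<beta> a' b')"
proof -
  note card = assms(1)
  note tr_add = abs_trace_add[OF card] and tr_0 = abs_trace_0[OF card]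
  note char2 = char2_add_self[OF card] char2_add_self_left[OF card] char2_two_eq_0[OF card]
  define \<gamma> where "\<gamma> = (\<beta> + 1) / (\<alpha> * \<beta> + 1)"
  have nz: "\<alpha> \<noteq> 0" "\<alpha> \<noteq> 1" "\<beta> \<noteq> 0" "\<beta> \<noteq> 1"
    using assms(2,3) by auto
  note elation = km_arc_elation_equivalent[OF card nz(1,3,4) assms(4), folded \<gamma>_def]
  have diffs: "a + a' \<in> {0, 1}" "b + b' \<in> {0, 1}"
    using assms(5-8) by (auto simp: char2)
  show ?thesis
  proof (cases "\<alpha> * \<beta> = \<beta> + 1")
    case False
    \<comment> \<open>Any shorter relation among these three elements would give \<alpha> = 1,
      \<beta> = 1 or \<alpha>\<beta> = 1.\<close>
    have "1 \<noteq> 1 / \<alpha> + 1 / (\<alpha> * \<beta>)"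
    proof
      assume "1 = 1 / \<alpha> + 1 / (\<alpha> * \<beta>)"
      then have "\<alpha> * \<beta> * 1 = \<alpha> * \<beta> * (1 / \<alpha> + 1 / (\<alpha> * \<beta>))"
        by simp
      with nz False show False
        by (simp add: distrib_left)
    qed
    then obtain u where "abs_trace h (1 * u) = 0" "abs_trace h (1 / \<alpha> * u) = a + a'"
      "abs_trace h (1 / (\<alpha> * \<beta>) * u) = b + b'"
      using ex_trace_eq3[OF card, of 1 "1 / \<alpha>" "1 / (\<alpha> * \<beta>)" 0 "a + a'" "b + b'"] nz assms(4) diffs
      by (auto simp: field_simps)
    then show ?thesis
      by (intro elation[where u = u and v = 0]) (simp_all add: tr_0)
  next
    case True
    have "\<alpha> * \<beta> + 1 = \<beta>"
      by (simp only: True add.assoc char2 add_0_right)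
    then have \<gamma>: "\<gamma> = \<alpha>"
      using nz by (simp add: \<gamma>_def flip: True)
    have inv: "1 / (\<alpha> * \<beta>) = 1 + 1 / \<alpha>"
    proof -
      have "1 + 1 / \<alpha> = (\<alpha> * \<beta> + \<beta>) / (\<alpha> * \<beta>)"
        using nz by (simp add: add_divide_distrib)
      also have "\<alpha> * \<beta> + \<beta> = 1"
        by (simp add: True char2 add_ac)
      finally show ?thesis ..
    qed
    have div: "x / (\<alpha> * \<beta>) = x + x / \<alpha>" for x
      using arg_cong[OF inv, of "(*) x"] by (simp add: distrib_left)
    obtain u where "abs_trace h (1 * u) = 0" "abs_trace h (1 / \<alpha> * u) = a + a'"
      using ex_trace_eq2[OF card, of 1 "1 / \<alpha>" 0 "a + a'"] nz diffs by auto
    then have u: "abs_trace h u = 0" "abs_trace h (u / \<alpha>) = a + a'"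
      "abs_trace h (u / (\<alpha> * \<beta>)) = a + a'"
      by (simp_all add: div tr_add)
    \<comment> \<open>The trace of \<open>u / (\<alpha> * \<beta>)\<close> is now bound to
      \<open>a + a'\<close>, so \<open>v\<close> has to supply any discrepancy with
      \<open>b + b'\<close>.\<close>
    have "a + a' = b + b' \<or> a + a' + 1 = b + b'"
      using diffs by (auto simp: char2)
    then consider (diff_eq) "a + a' = b + b'" | (diff_neq) "a + a' + 1 = b + b'" "\<alpha> * \<alpha> \<noteq> \<alpha> + 1"
      | (cube_root) "a + a' + 1 = b + b'" "\<alpha> * \<alpha> = \<alpha> + 1"
      by blast
    then show ?thesis
    proof cases
      case diff_eq
      with u show ?thesis
        by (intro elation[where u = u and v = 0]) (simp_all add: tr_0)
    next
      case diff_neq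
      \<comment> \<open>As \<gamma> = \<alpha>, the wanted \<open>v\<close> exists once
        \<open>1 / (\<alpha> * \<beta>)\<close> lies outside the span of 1 and
        \<open>1 / (\<alpha> * \<alpha>)\<close>.\<close>
      have "1 / (\<alpha> * \<beta>) \<noteq> 1 + 1 / (\<alpha> * \<alpha>)"
        unfolding inv using nz by simp
      moreover have "1 / (\<alpha> * \<beta>) \<noteq> 1 / (\<alpha> * \<alpha>)"
        using diff_neq(2) True nz by auto
      moreover have "1 / (\<alpha> * \<beta>) \<noteq> 1"
        using assms(4) by auto
      ultimately obtain v where "abs_trace h (1 / (\<alpha> * \<beta>) * v) = 1"
        "abs_trace h (1 * v) = 0" "abs_trace h (1 / (\<alpha> * \<alpha>) * v) = 0"
        using ex_trace_100[OF card, of "1 / (\<alpha> * \<beta>)" 1 "1 / (\<alpha> * \<alpha>)"] nz by auto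
      with u diff_neq(1) show ?thesis
        by (intro elation[where u = u and v = v]) (simp_all add: \<gamma>)
    next
      case cube_root
      have "(\<alpha> + 1) * \<beta> = 1" "(\<alpha> + 1) * \<alpha> = 1"
        by (simp_all add: distrib_right True cube_root(2) char2 add_ac)
      then have "\<beta> = \<alpha>"
        by (metis mult_cancel_left mult_zero_left zero_neq_one)
      \<comment> \<open>The first alternative is the cube root lemma; the second is the same lemma
        with the two arcs exchanged.\<close>
      moreover have "b = a \<and> b' = a' + 1 \<or> b = a + 1 \<and> b' = a'"
        using cube_root(1) assms(5-8) by (auto simp: char2)
      ultimately show ?thesis
        using km_arc_cube_root_equivalent[OF card cube_root(2) nz(1)] assms(5,6)
          PGL3_equivalent_sym km_arc_subset_PG2 by metis
    qed
  qed
qed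

end
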